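(* Let $d\in\mathbb{N}$, $0\le k<d$, and let $\{\mathcal{F}_n\}_{n\in\mathbb{N}}$ be an infinite sequence of families of axis-parallel boxes in $\mathbb{R}^d$. Suppose $\{\mathcal{F}_n\}_{n\in\mathbb{N}}$ satisfies the colorful $(\aleph_0,2)$-property for axis-parallel $k$-flats: for every strictly increasing sequence $n_1<n_2<\cdots$ of natural numbers and every choice of boxes $S_m\in\mathcal{F}_{n_m}$ ($m\in\mathbb{N}$), there exist $i\neq j$ and a single axis-parallel $k$-flat intersecting both $S_i$ and $S_j$. Then there exists $\ell\in\mathbb{N}$ such that $\mathcal{F}_\ell$ has an axis-parallel $k$-transversal of finite (constant) size, i.e. a finite family of axis-parallel $k$-flats such that every box of $\mathcal{F}_\ell$ intersects one of them.
   Context: An axis-parallel box in $\mathbb{R}^d$ is a set $[a_1,b_1]\times\cdots\times[a_d,b_d]$ with $a_i\le b_i$ real for all $i$. An axis-parallel $k$-flat in $\mathbb{R}^d$ is a set of the form $\{x\in\mathbb{R}^d : x_i=c_i \text{ for all } i\in I\}$ where $I\subseteq\{1,\dots,d\}$ has $|I|=d-k$ and $c_i\in\mathbb{R}$ are fixed. *)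

theory Defs
  imports "HOL-Analysis.Analysis"
begin

definition axis_parallel_box :: "(real ^ 'd) set \<Rightarrow> bool" where
  "axis_parallel_box S \<longleftrightarrow> (\<exists>a b. (\<forall>i. a $ i \<le> b $ i) \<and> S = cbox a b)"

text \<open>The condition \<open>|I| = d - k\<close> is written additively to avoid truncated subtraction;
  \<open>c\<close> is a full vector, but only its coordinates in \<open>I\<close> matter.\<close>

definition axis_parallel_flat :: "nat \<Rightarrow> (real ^ 'd) set \<Rightarrow> bool" where
  "axis_parallel_flat k L \<longleftrightarrow>
     (\<exists>(I :: 'd set) (c :: real ^ 'd).
        card I + k = CARD('d) \<and> L = {x. \<forall>i\<in>I. x $ i = c $ i})"

definition colorful_aleph0_2_property :: "nat \<Rightarrow> (nat \<Rightarrow> (real ^ 'd) set set) \<Rightarrow> bool" where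
  "colorful_aleph0_2_property k F \<longleftrightarrow>
     (\<forall>(r :: nat \<Rightarrow> nat) (S :: nat \<Rightarrow> (real ^ 'd) set).
        strict_mono r \<and> (\<forall>m. S m \<in> F (r m)) \<longrightarrow>
        (\<exists>i j L. i \<noteq> j \<and> axis_parallel_flat k L \<and> S i \<inter> L \<noteq> {} \<and> S j \<inter> L \<noteq> {}))"

definition axis_parallel_transversal ::
    "nat \<Rightarrow> (real ^ 'd) set set \<Rightarrow> (real ^ 'd) set set \<Rightarrow> bool" where
  "axis_parallel_transversal k T \<G> \<longleftrightarrow>
     (\<forall>L\<in>T. axis_parallel_flat k L) \<and> (\<forall>S\<in>\<G>. \<exists>L\<in>T. S \<inter> L \<noteq> {})"

end

theory Submission
  imports Defs "HOL-Library.Ramsey"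
begin

text \<open>
  Some \<open>k\<close>-flat meets two given boxes iff their projections intersect in at least \<open>d - k\<close> coordinates.
  If no \<open>F n\<close> has a finite transversal, the subfamilies of \<open>F n\<close> that have one form a proper
  ideal, and an ultrafilter \<open>U n\<close> avoids it. Call a coordinate pinned if some real
  number lies in the projection of almost every box of \<open>F n\<close>; fewer than \<open>d - k\<close>
  coordinates are pinned, as otherwise one flat would meet almost every box. In every other
  coordinate the projections converge along \<open>U n\<close> to a Dedekind cut of the line. By Ramsey's
  theorem we may pass to a subsequence along which the set of pinned coordinates is constant
  and all cuts are monotone in \<open>n\<close>. Then almost every box of \<open>F n\<close> straddles none of the later
  cuts, so boxes can be picked one after the other with disjoint projections in all coordinates
  that are not pinned; no \<open>k\<close>-flat meets two of them.
\<close>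

section \<open>Ultrafilters as minimal proper filters\<close>

definition ultrafilter :: "'a filter \<Rightarrow> bool" where
  "ultrafilter U \<longleftrightarrow> U \<noteq> bot \<and> (\<forall>P. eventually P U \<or> eventually (\<lambda>x. \<not> P x) U)"

lemma ultrafilter_not_bot: "ultrafilter U \<Longrightarrow> U \<noteq> bot"
  by (simp add: ultrafilter_def)

lemma ultrafilter_not_eventually:
  "ultrafilter U \<Longrightarrow> \<not> eventually P U \<Longrightarrow> eventually (\<lambda>x. \<not> P x) U"
  by (auto simp: ultrafilter_def)

text \<open>By Zorn's lemma there is a minimal proper filter below \<open>F\<close>. Restricting it
  to a set gives either \<open>bot\<close> or, by minimality, the same filter again, so it decides
  every predicate.\<close>

lemma ex_ultrafilter_le:
  fixes F :: "'a filter"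
  assumes "F \<noteq> bot"
  obtains U where "U \<le> F" "ultrafilter U"
proof -
  define A where "A = {G. G \<noteq> bot \<and> G \<le> F}"
  have "\<exists>U\<in>A. \<forall>G\<in>A. U \<ge> G \<longrightarrow> G = U"
  proof (rule predicate_Zorn)
    show "partial_order_on A (relation_of (\<ge>) A)"
      by (rule partial_order_on_relation_ofI) auto
  next
    fix C assume C: "C \<in> Chains (relation_of (\<ge>) A)"
    then have CA: "C \<subseteq> A"
      by (rule Chains_relation_of)
    have lin: "G \<le> H \<or> H \<le> G" if "G \<in> C" "H \<in> C" for G H
      using C that by (auto simp: Chains_def relation_of_def)
    show "\<exists>G\<in>A. \<forall>H\<in>C. H \<ge> G"
    proof (cases "C = {}")
      case True
      then show ?thesis using assms by (auto simp: A_def)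
    next
      case False
      \<comment> \<open>A chain is directed, so whatever holds eventually in its infimum already
        does so in one member; hence \<open>False\<close> does not.\<close>
      have "eventually P (Inf C) \<longleftrightarrow> (\<exists>G\<in>C. eventually P G)" for P
        by (rule eventually_Inf_base[OF False]) (use lin in \<open>auto intro: inf_greatest\<close>)
      then have "Inf C \<noteq> bot"
        using CA by (auto simp: A_def trivial_limit_def)
      moreover have "Inf C \<le> F"
        using False CA by (auto simp: A_def intro: Inf_lower2)
      ultimately have "Inf C \<in> A"
        by (simp add: A_def)
      then show ?thesis
        by (meson Inf_lower)
    qed
  qed
  then obtain U where U: "U \<noteq> bot" "U \<le> F"
    and max: "\<And>G. G \<noteq> bot \<Longrightarrow> G \<le> U \<Longrightarrow> G = U"
    unfolding A_def by (auto intro: order_trans)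
  have "eventually P U \<or> eventually (\<lambda>x. \<not> P x) U" for P
  proof (rule disjCI)
    assume "\<not> eventually (\<lambda>x. \<not> P x) U"
    then have "inf U (principal {x. P x}) \<noteq> bot"
      by (simp add: trivial_limit_def eventually_inf_principal)
    then have "inf U (principal {x. P x}) = U"
      by (rule max) simp
    moreover have "eventually P (inf U (principal {x. P x}))"
      by (simp add: eventually_inf_principal)
    ultimately show "eventually P U"
      by simp
  qed
  with U that show thesis
    by (auto simp: ultrafilter_def)
qed

section \<open>Choosing sequences: recursion along filters, and Ramsey's theorem\<close>

text \<open>At stage \<open>n\<close> the earlier values impose only finitely many conditions, each
  true eventually in \<open>U n\<close>, so some point meets them all. \<open>E\<close> is the
  invariant that keeps a chosen point harmless for all later filters.\<close>

lemma ex_sequence_eventually: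
  fixes U :: "nat \<Rightarrow> 'a filter"
  assumes "\<And>n. U n \<noteq> bot"
    and E: "\<And>n. eventually (E n) (U n)"
    and R: "\<And>m n x. m < n \<Longrightarrow> E m x \<Longrightarrow> eventually (R x) (U n)"
  obtains f where "\<And>n. E n (f n)" "\<And>m n. m < n \<Longrightarrow> R (f m) (f n)"
proof -
  have "\<exists>f. \<forall>n. E n (f n) \<and> (\<forall>m<n. R (f m) (f n))"
  proof (rule dependent_wf_choice[where R = less_than and P = "\<lambda>f n y. E n y \<and> (\<forall>m<n. R (f m) y)"])
    fix n and f :: "nat \<Rightarrow> 'a"
    assume "\<And>m. (m, n) \<in> less_than \<Longrightarrow> E m (f m) \<and> (\<forall>l<m. R (f l) (f m))"
    then have "\<forall>m\<in>{..<n}. eventually (R (f m)) (U n)"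
      using R by auto
    then have "eventually (\<lambda>y. \<forall>m\<in>{..<n}. R (f m) y) (U n)"
      by (simp add: eventually_ball_finite)
    with E[of n] have "eventually (\<lambda>y. E n y \<and> (\<forall>m<n. R (f m) y)) (U n)"
      by eventually_elim auto
    then show "\<exists>y. E n y \<and> (\<forall>m<n. R (f m) y)"
      using assms(1) eventually_happens by blast
  qed auto
  then show thesis
    using that by blast
qed

lemma Ramsey_pairs_of_nat:
  fixes p :: "nat \<Rightarrow> nat \<Rightarrow> 'c::finite"
  obtains r :: "nat \<Rightarrow> nat" and c where "strict_mono r" "\<And>m n. m < n \<Longrightarrow> p (r m) (r n) = c"
proof -
  obtain e :: "'c \<Rightarrow> nat" and s where e: "e ` UNIV = {i. i < s}" "inj_on e UNIV"
    using finite_imp_inj_to_nat_seg[OF finite_class.finite_UNIV] by blast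
  \<comment> \<open>\<open>Ramsey2\<close> colours unordered pairs with numbers: \<open>Min\<close>
    and \<open>Max\<close> restore the order, and \<open>e\<close> encodes the colours
    injectively.\<close>
  define q where "q X = e (p (Min X) (Max X))" for X
  have "\<forall>x\<in>UNIV. \<forall>y\<in>UNIV. x \<noteq> y \<longrightarrow> q {x, y} < s"
    using e(1) by (auto simp: q_def)
  from Ramsey2[OF infinite_UNIV_nat this]
  obtain Y t where Y: "infinite Y"
    and t: "\<And>x y. x \<in> Y \<Longrightarrow> y \<in> Y \<Longrightarrow> x \<noteq> y \<Longrightarrow> q {x, y} = t"
    by metis
  let ?r = "enumerate Y"
  have r: "strict_mono ?r"
    using Y by (rule strict_mono_enumerate)
  have et: "e (p (?r m) (?r n)) = t" if "m < n" for m n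
    using t[of "?r m" "?r n"] strict_monoD[OF r that] enumerate_in_set[OF Y]
    by (simp add: q_def min_def max_def)
  show thesis
  proof (rule that[OF r])
    show "p (?r m) (?r n) = p (?r 0) (?r 1)" if "m < n" for m n
      using et[OF that] et[of 0 1] e(2) by (metis UNIV_I inj_onD zero_less_one)
  qed
qed

section \<open>Cuts of the real line as limits along ultrafilters\<close>

text \<open>A set is used instead of an extended real limit because it also records whether
  \<open>f\<close> eventually stays strictly above a finite limit; inclusion then orders all cuts
  linearly.\<close>

definition lower_cut :: "'a filter \<Rightarrow> ('a \<Rightarrow> real) \<Rightarrow> real set" where
  "lower_cut U f = {c. eventually (\<lambda>x. c < f x) U}"

lemma lower_cut_downward: "c \<in> lower_cut U f \<Longrightarrow> c' \<le> c \<Longrightarrow> c' \<in> lower_cut U f"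
  unfolding lower_cut_def by (auto elim!: eventually_mono)

lemma lower_cut_linear: "lower_cut U f \<subseteq> lower_cut V g \<or> lower_cut V g \<subseteq> lower_cut U f"
  using lower_cut_downward by (metis linear subsetI)

text \<open>For an ultrafilter this is the negation of being pinned: no real number lies in
  \<open>[lo x, hi x]\<close> for almost every \<open>x\<close>.\<close>

definition escapes :: "'a filter \<Rightarrow> ('a \<Rightarrow> real) \<Rightarrow> ('a \<Rightarrow> real) \<Rightarrow> bool" where
  "escapes U lo hi \<longleftrightarrow> (\<forall>c. eventually (\<lambda>x. c < lo x \<or> hi x < c) U)"

text \<open>Thus the cut of \<open>lo\<close> controls both endpoints: points in it lie left of
  almost every interval, points outside it lie right of almost every interval.\<close>

lemma escapes_left:
  assumes "ultrafilter U" "escapes U lo hi" "c \<notin> lower_cut U lo"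
  shows "eventually (\<lambda>x. hi x < c) U"
proof -
  have "eventually (\<lambda>x. \<not> c < lo x) U"
    using assms by (simp add: lower_cut_def ultrafilter_not_eventually)
  moreover have "eventually (\<lambda>x. c < lo x \<or> hi x < c) U"
    using assms by (simp add: escapes_def)
  ultimately show ?thesis
    by eventually_elim auto
qed

text \<open>For a proper cut the supremum decides the side: if it belongs to the cut, almost all
  intervals lie to its right, otherwise to its left.\<close>

lemma eventually_not_straddling_own_cut:
  assumes "ultrafilter U" "escapes U lo hi"
  shows "eventually (\<lambda>x. hi x \<in> lower_cut U lo \<or> lo x \<notin> lower_cut U lo) U"
proof -
  let ?A = "lower_cut U lo"
  consider "?A = {}" | "?A = UNIV" | b where "?A \<noteq> {}" "b \<notin> ?A" by auto
  then show ?thesis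
  proof cases
    case 3
    have bdd: "bdd_above ?A"
      using 3 lower_cut_downward by (metis bdd_above.I linear)
    show ?thesis
    proof (cases "Sup ?A \<in> ?A")
      case True
      then have "eventually (\<lambda>x. Sup ?A < lo x) U"
        by (simp add: lower_cut_def)
      then show ?thesis
        by eventually_elim (use cSup_upper[OF _ bdd] in force)
    next
      case False
      then have "eventually (\<lambda>x. hi x < Sup ?A) U"
        using assms escapes_left by blast
      then show ?thesis
        by eventually_elim (use less_cSup_iff[OF 3(1) bdd] lower_cut_downward in \<open>metis less_imp_le\<close>)
    qed
  qed simp_all
qed

text \<open>Infinitely many conditions must hold at once, and ultrafilters need not be closed under
  countable intersections. Monotonicity reduces them to two: the own cut serves until the first
  change at \<open>p\<close>, and one point \<open>c\<close> between the cuts of \<open>m\<close>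
  and \<open>p\<close> serves from \<open>p\<close> on.\<close>

lemma eventually_not_straddling_later_cuts:
  fixes U :: "nat \<Rightarrow> 'a filter"
  assumes ultra: "\<And>n. ultrafilter (U n)" and esc: "\<And>n. escapes (U n) lo hi"
    and mono: "mono (\<lambda>n. lower_cut (U n) lo) \<or> antimono (\<lambda>n. lower_cut (U n) lo)"
  shows "eventually (\<lambda>x. \<forall>n>m. hi x \<in> lower_cut (U n) lo \<or> lo x \<notin> lower_cut (U n) lo) (U m)"
proof -
  let ?A = "\<lambda>n. lower_cut (U n) lo"
  note own = eventually_not_straddling_own_cut[OF ultra esc, of m]
  show ?thesis
  proof (cases "\<exists>n>m. ?A n \<noteq> ?A m")
    case False
    with own show ?thesis
      by (auto elim!: eventually_mono)
  next
    case True
    define p where "p = (LEAST n. n > m \<and> ?A n \<noteq> ?A m)"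
    have p: "p > m" "?A p \<noteq> ?A m"
      using LeastI_ex[OF True] by (auto simp: p_def)
    have before: "?A n = ?A m" if "m < n" "n < p" for n
      using not_less_Least[of n "\<lambda>n. n > m \<and> ?A n \<noteq> ?A m"] that by (auto simp: p_def)
    from mono show ?thesis
    proof
      assume mono: "mono ?A"
      then have "?A m \<subseteq> ?A p"
        using p(1) by (meson monoD less_imp_le)
      then obtain c where c: "c \<in> ?A p" "c \<notin> ?A m"
        using p(2) by blast
      from own escapes_left[OF ultra esc c(2)] show ?thesis
      proof eventually_elim
        case (elim x)
        have "hi x \<in> ?A n" if "n \<ge> p" for n
          using monoD[OF mono that] c(1) elim(2) by (meson less_imp_le lower_cut_downward subsetD)
        with elim(1) before show ?case
          by (metis not_less)
      qed
    next
      assume anti: "antimono ?A"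
      then have "?A p \<subseteq> ?A m"
        using p(1) antimonoD[of _ m p] by auto
      then obtain c where c: "c \<in> ?A m" "c \<notin> ?A p"
        using p(2) by blast
      from c(1) have "eventually (\<lambda>x. c < lo x) (U m)"
        by (simp add: lower_cut_def)
      with own show ?thesis
      proof eventually_elim
        case (elim x)
        have "lo x \<notin> ?A n" if "n \<ge> p" for n
          using antimonoD[OF anti that] c(2) elim(2) by (meson less_imp_le lower_cut_downward subsetD)
        with elim(1) before show ?case
          by (metis not_less)
      qed
    qed
  qed
qed

text \<open>The intervals close in on the cut, so they leave behind any fixed \<open>[a, b]\<close>
  lying on one side of it.\<close>

lemma eventually_disjoint_of_not_straddling:
  assumes "ultrafilter U" "escapes U lo hi" "b \<in> lower_cut U lo \<or> a \<notin> lower_cut U lo"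
  shows "eventually (\<lambda>y. b < lo y \<or> hi y < a) U"
  using assms(3)
proof
  assume "b \<in> lower_cut U lo"
  then show ?thesis
    by (auto simp: lower_cut_def elim!: eventually_mono)
next
  assume "a \<notin> lower_cut U lo"
  from escapes_left[OF assms(1,2) this] show ?thesis
    by (auto elim!: eventually_mono)
qed

section \<open>Boxes, flats and finite transversals\<close>

lemma ultrafilter_avoiding_transversals:
  assumes "\<nexists>T. finite T \<and> axis_parallel_transversal k T \<G>"
  obtains U where "ultrafilter U" "eventually (\<lambda>S. S \<in> \<G>) U"
    "\<And>L. axis_parallel_flat k L \<Longrightarrow> eventually (\<lambda>S. S \<inter> L = {}) U"
proof -
  \<comment> \<open>The exceptions to \<open>P\<close> are pierced by finitely many flats. Uniting
    transversals gives closure under conjunction, and the assumption says exactly that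
    \<open>False\<close> is excluded.\<close>
  define ev where
    "ev P \<longleftrightarrow> (\<exists>T. finite T \<and> axis_parallel_transversal k T {S \<in> \<G>. \<not> P S})" for P
  define \<Phi> where "\<Phi> = Abs_filter ev"
  have "is_filter ev"
  proof
    show "ev (\<lambda>_. True)"
      unfolding ev_def axis_parallel_transversal_def by (rule exI[of _ "{}"]) auto
  next
    fix P Q assume "ev P" "ev Q"
    then obtain T T' where "finite T" "axis_parallel_transversal k T {S \<in> \<G>. \<not> P S}"
      "finite T'" "axis_parallel_transversal k T' {S \<in> \<G>. \<not> Q S}"
      by (auto simp: ev_def)
    then show "ev (\<lambda>S. P S \<and> Q S)"
      unfolding ev_def axis_parallel_transversal_def by (intro exI[of _ "T \<union> T'"]) blast
  next
    fix P Q assume PQ: "\<forall>S. P S \<longrightarrow> Q S" and "ev P"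
    then obtain T where "finite T" "axis_parallel_transversal k T {S \<in> \<G>. \<not> P S}"
      by (auto simp: ev_def)
    with PQ show "ev Q"
      unfolding ev_def axis_parallel_transversal_def by (intro exI[of _ T]) auto
  qed
  then have ev: "eventually P \<Phi> \<longleftrightarrow> ev P" for P
    by (simp add: \<Phi>_def eventually_Abs_filter)
  have "\<Phi> \<noteq> bot"
    using assms by (simp add: trivial_limit_def ev ev_def)
  then obtain U where U: "U \<le> \<Phi>" "ultrafilter U"
    by (rule ex_ultrafilter_le)
  show thesis
  proof (rule that[OF U(2)])
    have "ev (\<lambda>S. S \<in> \<G>)"
      unfolding ev_def axis_parallel_transversal_def by (rule exI[of _ "{}"]) auto
    then show "eventually (\<lambda>S. S \<in> \<G>) U"
      using U(1) ev by (simp add: filter_leD)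
  next
    fix L :: "(real ^ 'a) set" assume "axis_parallel_flat k L"
    then have "ev (\<lambda>S. S \<inter> L = {})"
      unfolding ev_def axis_parallel_transversal_def by (intro exI[of _ "{L}"]) auto
    then show "eventually (\<lambda>S. S \<inter> L = {}) U"
      using U(1) ev by (simp add: filter_leD)
  qed
qed

lemma cbox_meets_axis_parallel_iff:
  fixes a b c :: "real ^ 'd"
  assumes "\<And>i. a $ i \<le> b $ i"
  shows "cbox a b \<inter> {x. \<forall>i\<in>I. x $ i = c $ i} \<noteq> {} \<longleftrightarrow> (\<forall>i\<in>I. a $ i \<le> c $ i \<and> c $ i \<le> b $ i)"
proof
  assume "\<forall>i\<in>I. a $ i \<le> c $ i \<and> c $ i \<le> b $ i"
  \<comment> \<open>Coordinates outside \<open>I\<close> are free; the default \<open>a $ i\<close>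
    keeps the point in the box.\<close>
  then have "(\<chi> i. if i \<in> I then c $ i else a $ i) \<in> cbox a b \<inter> {x. \<forall>i\<in>I. x $ i = c $ i}"
    using assms by (auto simp: mem_box_cart)
  then show "cbox a b \<inter> {x. \<forall>i\<in>I. x $ i = c $ i} \<noteq> {}"
    by blast
next
  assume "cbox a b \<inter> {x. \<forall>i\<in>I. x $ i = c $ i} \<noteq> {}"
  then obtain x where "x \<in> cbox a b" "\<forall>i\<in>I. x $ i = c $ i"
    by blast
  then show "\<forall>i\<in>I. a $ i \<le> c $ i \<and> c $ i \<le> b $ i"
    by (metis mem_box_cart(2))
qed

section \<open>Boxes of which no two meet a common flat\<close>

theorem theorem8:
  fixes k :: nat and F :: "nat \<Rightarrow> (real ^ 'd) set set"
  assumes "k < CARD('d)"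
    and "\<And>n S. S \<in> F n \<Longrightarrow> axis_parallel_box S"
    and "colorful_aleph0_2_property k F"
  shows "\<exists>l T. finite T \<and> axis_parallel_transversal k T (F l)"
proof (rule ccontr)
  assume "\<nexists>l T. finite T \<and> axis_parallel_transversal k T (F l)"
  then have "\<exists>U. ultrafilter U \<and> eventually (\<lambda>S. S \<in> F n) U \<and>
      (\<forall>L. axis_parallel_flat k L \<longrightarrow> eventually (\<lambda>S. S \<inter> L = {}) U)" for n
    using ultrafilter_avoiding_transversals[of k "F n"] by metis
  then obtain U where U: "\<And>n. ultrafilter (U n)" and UF: "\<And>n. eventually (\<lambda>S. S \<in> F n) (U n)"
    and avoid: "\<And>n L. axis_parallel_flat k L \<Longrightarrow> eventually (\<lambda>S. S \<inter> L = {}) (U n)"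
    by metis
  have "\<exists>a b. axis_parallel_box S \<longrightarrow> (\<forall>i. a $ i \<le> b $ i) \<and> S = cbox a b" for S :: "(real ^ 'd) set"
    by (auto simp: axis_parallel_box_def)
  then obtain lo hi :: "(real ^ 'd) set \<Rightarrow> real ^ 'd"
    where "\<And>S. axis_parallel_box S \<Longrightarrow> (\<forall>i. lo S $ i \<le> hi S $ i) \<and> S = cbox (lo S) (hi S)"
    by metis
  then have le: "lo S $ i \<le> hi S $ i" and S_eq: "S = cbox (lo S) (hi S)" if "S \<in> F n" for S n i
    using assms(2)[OF that] by blast+
  have meets: "S \<inter> {x. \<forall>i\<in>I. x $ i = c $ i} \<noteq> {} \<longleftrightarrow> (\<forall>i\<in>I. lo S $ i \<le> c $ i \<and> c $ i \<le> hi S $ i)"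
    if "S \<in> F n" for S n I and c :: "real ^ 'd"
    using cbox_meets_axis_parallel_iff[of "lo S" "hi S" I c] le[OF that] S_eq[OF that] by simp
  define pinned where
    "pinned n = {i. \<exists>c. eventually (\<lambda>S. lo S $ i \<le> c \<and> c \<le> hi S $ i) (U n)}" for n
  have card_pinned: "card (pinned n) + k < CARD('d)" for n
  proof (rule ccontr)
    assume "\<not> ?thesis"
    then obtain I where I: "I \<subseteq> pinned n" "card I = CARD('d) - k"
      by (metis add.commute le_diff_conv linorder_not_less obtain_subset_with_card_n)
    have "\<forall>i\<in>I. \<exists>c. eventually (\<lambda>S. lo S $ i \<le> c \<and> c \<le> hi S $ i) (U n)"
      using I(1) by (auto simp: pinned_def)
    from bchoice[OF this] obtain c
      where c: "\<forall>i\<in>I. eventually (\<lambda>S. lo S $ i \<le> c i \<and> c i \<le> hi S $ i) (U n)" ..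
    let ?L = "{x. \<forall>i\<in>I. x $ i = (\<chi> i. c i) $ i}"
    have "axis_parallel_flat k ?L"
      unfolding axis_parallel_flat_def using I(2) assms(1) by (intro exI[of _ I] exI[of _ "\<chi> i. c i"]) auto
    then have "eventually (\<lambda>S. S \<inter> ?L = {}) (U n)"
      by (rule avoid)
    moreover have "eventually (\<lambda>S. \<forall>i\<in>I. lo S $ i \<le> c i \<and> c i \<le> hi S $ i) (U n)"
      using c by (simp add: eventually_ball_finite)
    ultimately have "eventually (\<lambda>S. False) (U n)"
      using UF[of n]
    proof eventually_elim
      case (elim S)
      then show ?case using meets[of S n I "\<chi> i. c i"] by simp
    qed
    then show False
      using ultrafilter_not_bot[OF U] by (simp add: trivial_limit_def)
  qed
  have esc: "escapes (U n) (\<lambda>S. lo S $ i) (\<lambda>S. hi S $ i)" if "i \<notin> pinned n" for i n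
    unfolding escapes_def
  proof
    fix c
    have "\<not> eventually (\<lambda>S. lo S $ i \<le> c \<and> c \<le> hi S $ i) (U n)"
      using that by (auto simp: pinned_def)
    from ultrafilter_not_eventually[OF U this]
    show "eventually (\<lambda>S. c < lo S $ i \<or> hi S $ i < c) (U n)"
      by eventually_elim auto
  qed

  define cut where "cut n i = lower_cut (U n) (\<lambda>S. lo S $ i)" for n i
  \<comment> \<open>The colour of a pair consists of two sets of coordinates, so there are finitely
    many colours. Its first component depends on the smaller index only, which makes the pinned set
    constant.\<close>
  obtain r :: "nat \<Rightarrow> nat" and P J :: "'d set" where r: "strict_mono r"
    and rJ: "\<And>m n. m < n \<Longrightarrow> (pinned (r m), {i. cut (r m) i \<subseteq> cut (r n) i}) = (P, J)"
    using Ramsey_pairs_of_nat[of "\<lambda>m n. (pinned m, {i. cut m i \<subseteq> cut n i})"] by (metis surj_pair)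
  have P: "pinned (r n) = P" for n
    using rJ[of n "Suc n"] by simp
  have J: "cut (r m) i \<subseteq> cut (r n) i \<longleftrightarrow> i \<in> J" if "m < n" for m n i
    using rJ[OF that] by auto
  have monotone: "mono (\<lambda>n. cut (r n) i) \<or> antimono (\<lambda>n. cut (r n) i)" for i
  proof (cases "i \<in> J")
    case True
    then show ?thesis
      using J by (auto simp: mono_iff_le_Suc)
  next
    case False
    \<comment> \<open>Cuts are comparable, so a failed inclusion yields the reverse one.\<close>
    then have "cut (r (Suc n)) i \<subseteq> cut (r n) i" for n
      using J[of n "Suc n" i] lower_cut_linear unfolding cut_def by blast
    then show ?thesis
      by (auto simp: antimono_iff_le_Suc)
  qed

  \<comment> \<open>Membership in \<open>E m\<close> concerns all later cuts because the box is
    fixed before any later box is chosen.\<close>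
  define E where "E m S \<longleftrightarrow> S \<in> F (r m) \<and>
    (\<forall>i\<in>-P. \<forall>n>m. hi S $ i \<in> cut (r n) i \<or> lo S $ i \<notin> cut (r n) i)" for m S
  define R where "R S S' \<longleftrightarrow> (\<forall>i\<in>-P. hi S $ i < lo S' $ i \<or> hi S' $ i < lo S $ i)" for S S'
  obtain f where f: "\<And>n. E n (f n)" "\<And>m n. m < n \<Longrightarrow> R (f m) (f n)"
  proof (rule ex_sequence_eventually[of "\<lambda>n. U (r n)" E R])
    show "U (r n) \<noteq> bot" for n
      using U by (rule ultrafilter_not_bot)
    show "eventually (E m) (U (r m))" for m
      unfolding E_def
    proof (intro eventually_conj UF eventually_ball_finite ballI)
      fix i assume "i \<in> -P"
      then show "eventually (\<lambda>S. \<forall>n>m. hi S $ i \<in> cut (r n) i \<or> lo S $ i \<notin> cut (r n) i) (U (r m))"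
        using eventually_not_straddling_later_cuts[of "\<lambda>n. U (r n)"] U esc P monotone[of i]
        unfolding cut_def by simp
    qed simp
    show "eventually (R S) (U (r n))" if "m < n" "E m S" for m n S
      unfolding R_def
    proof (intro eventually_ball_finite ballI)
      fix i assume i: "i \<in> -P"
      then have "hi S $ i \<in> cut (r n) i \<or> lo S $ i \<notin> cut (r n) i"
        using that by (simp add: E_def)
      moreover have "escapes (U (r n)) (\<lambda>S. lo S $ i) (\<lambda>S. hi S $ i)"
        using i P esc by simp
      ultimately show "eventually (\<lambda>S'. hi S $ i < lo S' $ i \<or> hi S' $ i < lo S $ i) (U (r n))"
        using eventually_disjoint_of_not_straddling[OF U] unfolding cut_def by blast
    qed simp
  qed blast

  have fF: "f m \<in> F (r m)" for m
    using f(1) by (simp add: E_def)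
  have "\<exists>m n L. m \<noteq> n \<and> axis_parallel_flat k L \<and> f m \<inter> L \<noteq> {} \<and> f n \<inter> L \<noteq> {}"
    by (rule assms(3)[unfolded colorful_aleph0_2_property_def, rule_format, of r]) (simp add: r fF)
  then obtain m n L where mn: "m \<noteq> n"
    and L: "axis_parallel_flat k L" "f m \<inter> L \<noteq> {}" "f n \<inter> L \<noteq> {}"
    by blast
  from L(1) obtain I c where I: "card I + k = CARD('d)" and L_eq: "L = {x. \<forall>i\<in>I. x $ i = c $ i}"
    unfolding axis_parallel_flat_def by blast
  have c: "lo (f l) $ i \<le> c $ i \<and> c $ i \<le> hi (f l) $ i" if "i \<in> I" "l \<in> {m, n}" for i l
    using that L(2,3) meets[OF fF] unfolding L_eq by auto
  \<comment> \<open>A common flat would fix only pinned coordinates, since in every other one the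
    two projections are disjoint; but there are fewer than \<open>d - k\<close> pinned ones.\<close>
  have "I \<subseteq> P"
  proof
    fix i assume i: "i \<in> I"
    show "i \<in> P"
    proof (rule ccontr)
      assume "i \<notin> P"
      with mn f(2)[of m n] f(2)[of n m]
      have "hi (f m) $ i < lo (f n) $ i \<or> hi (f n) $ i < lo (f m) $ i"
        unfolding R_def by (metis ComplI linorder_neqE_nat)
      with c[OF i, of m] c[OF i, of n] show False
        by auto
    qed
  qed
  then have "card I \<le> card P"
    by (simp add: card_mono)
  with I card_pinned[of "r 0"] P show False
    by simp
qed

end
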